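(* Let $a>b>1$ be fixed and consider the majority dynamics process described in the context, with a fixed initial configuration $y_0$ for each $N$. Let $\rho_0=|B_0|/|R_0|$ and suppose $$1<\rho_0\le a/b-\kappa,$$ where $\kappa>0$ is fixed. Then for every fixed $\varepsilon>0$ there is $C=C(a,b,\kappa,\varepsilon)>0$ such that, for all sufficiently large $N$, $$\mathbb P\left(R_{\lfloor N^{I_0-\varepsilon}\rfloor}\ne\emptyset\right)\ge 1-CN^{-\varepsilon/2}.$$
   Context: Process. Fix constants $a>b>1$ and put $\alpha=a\log N/N$, $\beta=b\log N/N$ ($N$ large enough that $\alpha\le 1$; natural logarithm). Let $V=[N]=\{1,\dots,N\}$. An opinion configuration is $y_t\in\{\pm1\}^V$, with $B_t=\{v:y_t(v)=+1\}$ (blue) and $R_t=\{v:y_t(v)=-1\}$ (red). For each $N$ the initial configuration $y_0$ is fixed; let $\mathcal F_t=\sigma(y_0,G_1,\dots,G_t)$. Conditionally on $\mathcal F_t$, $G_{t+1}$ is a random graph on $V$ in which each pair $\{u,v\}$, $u\ne v$, is an edge independently with probability $\alpha$ if $y_t(u)=y_t(v)$ and $\beta$ otherwise. All vertices update synchronously: $y_{t+1}(v)=+1$ if $v$ has strictly more $G_{t+1}$-neighbors in $B_t$ than in $R_t$, $y_{t+1}(v)=-1$ if strictly fewer, and $y_{t+1}(v)=y_t(v)$ in case of a tie. Exponent. $I(x,y)=\big(\max\{\sqrt x-\sqrt y,0\}\big)^2$ and $I_0=I\big(a|R_0|/N,\;b|B_0|/N\big)$ (which may depend on $N$). *)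

theory Defs
  imports "HOL-Probability.Probability"
begin

type_synonym opinions = "nat \<Rightarrow> int"
type_synonym edges = "nat set set"

definition vertices :: "nat \<Rightarrow> nat set" where
  "vertices N = {1..N}"

definition pairs :: "nat \<Rightarrow> edges" where
  "pairs N = {{u, v} | u v. u \<in> vertices N \<and> v \<in> vertices N \<and> u \<noteq> v}"

definition blue :: "nat \<Rightarrow> opinions \<Rightarrow> nat set" where
  "blue N y = {v \<in> vertices N. y v = 1}"

definition red :: "nat \<Rightarrow> opinions \<Rightarrow> nat set" where
  "red N y = {v \<in> vertices N. y v = -1}"

definition neighbours :: "edges \<Rightarrow> nat \<Rightarrow> nat set" where
  "neighbours E v = {u. u \<noteq> v \<and> {u, v} \<in> E}"

definition majority_update :: "nat \<Rightarrow> opinions \<Rightarrow> edges \<Rightarrow> opinions" where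
  "majority_update N y E = (\<lambda>v.
     if card (neighbours E v \<inter> blue N y) > card (neighbours E v \<inter> red N y) then 1
     else if card (neighbours E v \<inter> blue N y) < card (neighbours E v \<inter> red N y) then -1
     else y v)"

text \<open>The configuration after \<open>t\<close> steps, driven by the graphs \<open>E 1, E 2, \<dots>\<close>
  (the value \<open>E 0\<close> is never used).\<close>

primrec opinion :: "nat \<Rightarrow> opinions \<Rightarrow> (nat \<Rightarrow> edges) \<Rightarrow> nat \<Rightarrow> opinions" where
  "opinion N y0 E 0 = y0"
| "opinion N y0 E (Suc t) = majority_update N (opinion N y0 E t) (E (Suc t))"

definition edge_scale :: "real \<Rightarrow> nat \<Rightarrow> real" where
  "edge_scale c N = c * ln (real N) / real N"

definition edge_prob :: "real \<Rightarrow> real \<Rightarrow> nat \<Rightarrow> opinions \<Rightarrow> nat set \<Rightarrow> real" where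
  "edge_prob a b N y e =
     (if \<forall>u\<in>e. \<forall>v\<in>e. y u = y v then edge_scale a N else edge_scale b N)"

text \<open>The edge set obtained by keeping each pair \<open>e\<close> independently with probability
  \<open>edge_prob a b N y e\<close>.\<close>

definition graph_pmf :: "real \<Rightarrow> real \<Rightarrow> nat \<Rightarrow> opinions \<Rightarrow> edges pmf" where
  "graph_pmf a b N y =
     map_pmf (\<lambda>X. {e \<in> pairs N. X e})
       (Pi_pmf (pairs N) False (\<lambda>e. bernoulli_pmf (edge_prob a b N y e)))"

definition history :: "'w measure \<Rightarrow> (nat \<Rightarrow> 'w \<Rightarrow> edges) \<Rightarrow> nat \<Rightarrow> 'w measure" where
  "history M G t =
     sigma (space M) {G s -` A \<inter> space M | s A. 1 \<le> s \<and> s \<le> t}"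

text \<open>A realisation of the process on \<open>N\<close> vertices on an arbitrary probability space
  \<open>M\<close>. The initial configuration \<open>y0\<close> is deterministic, so it contributes nothing to
  the sigma-algebra \<open>history M G t\<close>. Since there are only finitely many graphs on
  \<open>vertices N\<close>, the conditional law of \<open>G (Suc t)\<close> is given by its point
  probabilities.\<close>

locale majority_dynamics = prob_space M
  for M :: "'w measure" and a b :: real and N :: nat and y0 :: opinions
    and G :: "nat \<Rightarrow> 'w \<Rightarrow> edges" +
  assumes scale_le_1: "edge_scale a N \<le> 1"
    and initial: "\<And>v. v \<in> vertices N \<Longrightarrow> y0 v \<in> {1, -1}"
    and graph: "\<And>t. t \<ge> 1 \<Longrightarrow> G t \<in> measurable M (count_space (Pow (pairs N)))"
    and conditional_law: "\<And>t E. E \<subseteq> pairs N \<Longrightarrow>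
      AE \<omega> in M. real_cond_exp M (history M G t)
          (indicator {\<omega> \<in> space M. G (Suc t) \<omega> = E}) \<omega>
        = pmf (graph_pmf a b N (opinion N y0 (\<lambda>s. G s \<omega>) t)) E"

definition rate :: "real \<Rightarrow> real \<Rightarrow> real" where
  "rate x y = (max (sqrt x - sqrt y) 0)\<^sup>2"

definition initial_rate :: "real \<Rightarrow> real \<Rightarrow> nat \<Rightarrow> opinions \<Rightarrow> real" where
  "initial_rate a b N y0 =
     rate (a * real (card (red N y0)) / real N) (b * real (card (blue N y0)) / real N)"

text \<open>If there is no red vertex this is \<open>0\<close>, so \<open>1 < initial_ratio N y0\<close> entails that
  \<open>red N y0\<close> is nonempty.\<close>

definition initial_ratio :: "nat \<Rightarrow> opinions \<Rightarrow> real" where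
  "initial_ratio N y0 = real (card (blue N y0)) / real (card (red N y0))"

end

theory Submission
  imports Defs
begin

text \<open>
  Red survives because red vertices turn blue too rarely. Write \<open>R\<^sub>0\<close> and \<open>B\<^sub>0\<close> for the initial
  numbers of red and blue vertices and \<open>I\<^sub>0\<close> for \<open>initial_rate a b N y0\<close>. A red vertex turns blue
  only if a binomial number of blue neighbours with mean about \<open>b B\<^sub>0 ln N / N\<close> exceeds a binomial
  number of red neighbours with the larger mean \<open>a R\<^sub>0 ln N / N\<close>. Chernoff's bound puts the
  probability of this at \<open>O(N powr (- I\<^sub>0))\<close>: the lemma \<open>prob_blue_leads_le\<close> gives the bound for an
  arbitrary tilt, and \<open>optimal_tilt\<close> identifies the exponent at the best tilt as the rate.

  Put \<open>d = N powr (1 - \<epsilon> / 2)\<close>. The bound persists, up to a constant factor, for every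
  configuration with at least \<open>R\<^sub>0 - d\<close> red vertices
  (\<open>prob_blue_leads_le_initial_rate\<close>): losing \<open>d\<close> red vertices shifts the means by
  \<open>O(N powr (- \<epsilon> / 2) * ln N)\<close>, which tends to \<open>0\<close>, and having more red vertices only helps.
  Hence, as long as the red set stays this large, the expected number of vertices that turn from
  red to blue in one round is \<open>O(N powr (1 - I\<^sub>0))\<close>, and over \<open>N powr (I\<^sub>0 - \<epsilon>)\<close> rounds it is
  \<open>O(N powr (1 - \<epsilon>))\<close>. The red set can only drop below \<open>R\<^sub>0 - d\<close> after at least \<open>d\<close> such defections,
  so by Markov's inequality this has probability \<open>O(N powr (- \<epsilon> / 2))\<close> (\<open>prob_few_red_le\<close>).
  Since \<open>R\<^sub>0\<close> is of order \<open>N\<close>, the number \<open>R\<^sub>0 - d\<close> is positive, so outside this event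
  some vertex is still red.
\<close>

section \<open>One round: the probability that a red vertex turns blue\<close>

text \<open>Exponential moments of weighted sums of independent Bernoulli variables are bounded by those
  of the corresponding Poisson variables, through \<open>1 + t \<le> exp t\<close>.\<close>

lemma expectation_prod_Pi_pmf_bernoulli_le:
  fixes p c :: "'a \<Rightarrow> real"
  assumes "finite A" and "\<And>e. e \<in> A \<Longrightarrow> 0 \<le> p e" "\<And>e. e \<in> A \<Longrightarrow> p e \<le> 1"
    and "\<And>e. e \<in> A \<Longrightarrow> 0 \<le> c e"
  shows "measure_pmf.expectation (Pi_pmf A False (\<lambda>e. bernoulli_pmf (p e)))
      (\<lambda>X. \<Prod>e\<in>A. if X e then c e else 1) \<le> exp (\<Sum>e\<in>A. p e * (c e - 1))"
proof -
  have "measure_pmf.expectation (Pi_pmf A False (\<lambda>e. bernoulli_pmf (p e)))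
      (\<lambda>X. \<Prod>e\<in>A. if X e then c e else 1)
    = (\<Prod>e\<in>A. measure_pmf.expectation (bernoulli_pmf (p e)) (\<lambda>x. if x then c e else 1))"
    by (rule expectation_prod_Pi_pmf[where f = "\<lambda>e x. if x then c e else 1"])
      (use assms in \<open>auto intro!: integrable_measure_pmf_finite\<close>)
  also have "\<dots> = (\<Prod>e\<in>A. 1 + p e * (c e - 1))"
    using assms by (intro prod.cong) (auto simp: algebra_simps)
  also have "\<dots> \<le> (\<Prod>e\<in>A. exp (p e * (c e - 1)))"
  proof (intro prod_mono conjI)
    fix e assume "e \<in> A"
    then have "0 \<le> p e * c e" "p e \<le> 1" using assms by auto
    then show "0 \<le> 1 + p e * (c e - 1)" by (simp add: algebra_simps)
  qed (rule exp_ge_add_one_self)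
  finally show ?thesis using assms(1) by (simp add: exp_sum)
qed

lemma finite_pairs [simp]: "finite (pairs N)"
  by (rule finite_subset[of _ "Pow (vertices N)"]) (auto simp: pairs_def vertices_def)

lemma finite_vertices [simp]: "finite (vertices N)"
  by (simp add: vertices_def)

lemma finite_blue [simp]: "finite (blue N y)" and finite_red [simp]: "finite (red N y)"
  by (simp_all add: blue_def red_def)

lemma card_blue_add_card_red:
  assumes "\<And>v. v \<in> vertices N \<Longrightarrow> y v \<in> {1, -1}"
  shows "card (blue N y) + card (red N y) = N"
proof -
  have "blue N y \<union> red N y = vertices N" using assms by (auto simp: blue_def red_def)
  moreover have "blue N y \<inter> red N y = {}" by (auto simp: blue_def red_def)
  ultimately show ?thesis
    by (metis card_Un_disjoint finite_blue finite_red vertices_def card_atLeastAtMost diff_Suc_1)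
qed

lemma majority_update_values:
  "y v \<in> {1, -1} \<Longrightarrow> majority_update N y E v \<in> {1, -1}"
  by (auto simp: majority_update_def)

lemma turns_blue_iff:
  assumes "v \<in> red N y"
  shows "v \<notin> red N (majority_update N y E) \<longleftrightarrow>
    card (neighbours E v \<inter> blue N y) > card (neighbours E v \<inter> red N y)"
  using assms by (auto simp: red_def majority_update_def)

text \<open>The contribution of a potential edge to the lead of blue over red among the neighbours
  of \<open>v\<close>. Writing the lead as a sum over all pairs turns exponential moments of it into
  products over independent edges.\<close>

definition lead_weight :: "nat \<Rightarrow> opinions \<Rightarrow> nat \<Rightarrow> nat set \<Rightarrow> real" where
  "lead_weight N y v e =
     (if e \<in> (\<lambda>u. {u, v}) ` (blue N y - {v}) then 1
      else if e \<in> (\<lambda>u. {u, v}) ` (red N y - {v}) then -1 else 0)"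

lemma lead_weight_blue: "u \<in> blue N y \<Longrightarrow> u \<noteq> v \<Longrightarrow> lead_weight N y v {u, v} = 1"
  by (auto simp: lead_weight_def)

lemma lead_weight_red: "u \<in> red N y \<Longrightarrow> u \<noteq> v \<Longrightarrow> lead_weight N y v {u, v} = -1"
  by (auto simp: lead_weight_def blue_def red_def doubleton_eq_iff)

text \<open>Only pairs that contain \<open>v\<close> carry weight, and these are indexed by their other end point.\<close>

lemma sum_pairs_star:
  fixes g :: "nat set \<Rightarrow> real"
  assumes "v \<in> vertices N" and "\<And>e. lead_weight N y v e = 0 \<Longrightarrow> g e = 0"
  shows "(\<Sum>e\<in>pairs N. g e) = (\<Sum>u\<in>blue N y - {v}. g {u, v}) + (\<Sum>u\<in>red N y - {v}. g {u, v})"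
proof -
  let ?B = "(\<lambda>u. {u, v}) ` (blue N y - {v})" and ?R = "(\<lambda>u. {u, v}) ` (red N y - {v})"
  have inj: "inj_on (\<lambda>u. {u, v}) A" for A
    by (auto simp: inj_on_def doubleton_eq_iff)
  have "?B \<union> ?R \<subseteq> pairs N"
    using assms(1) unfolding pairs_def blue_def red_def by blast
  then have "(\<Sum>e\<in>pairs N. g e) = (\<Sum>e\<in>?B \<union> ?R. g e)"
    using assms(2) by (intro sum.mono_neutral_right) (auto simp: lead_weight_def)
  also have "\<dots> = (\<Sum>e\<in>?B. g e) + (\<Sum>e\<in>?R. g e)"
    by (rule sum.union_disjoint) (auto simp: blue_def red_def doubleton_eq_iff)
  finally show ?thesis
    by (simp add: sum.reindex[OF inj] o_def)
qed

lemma sum_lead_weight: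
  assumes "v \<in> vertices N"
  shows "(\<Sum>e\<in>pairs N. if e \<in> E then lead_weight N y v e else 0) =
    real (card (neighbours E v \<inter> blue N y)) - real (card (neighbours E v \<inter> red N y))"
proof -
  have eq: "(\<Sum>u\<in>A - {v}. if {u, v} \<in> E then 1 else 0 :: real) = real (card (neighbours E v \<inter> A))"
    if "finite A" for A
  proof -
    have "(A - {v}) \<inter> {u. {u, v} \<in> E} = neighbours E v \<inter> A"
      by (auto simp: neighbours_def)
    then show ?thesis using that by (simp add: sum.If_cases)
  qed
  have "(\<Sum>u\<in>blue N y - {v}. if {u, v} \<in> E then lead_weight N y v {u, v} else 0)
      = (\<Sum>u\<in>blue N y - {v}. if {u, v} \<in> E then 1 else 0)"
    by (intro sum.cong) (auto simp: lead_weight_blue)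
  moreover have "(\<Sum>u\<in>red N y - {v}. if {u, v} \<in> E then lead_weight N y v {u, v} else 0)
      = - (\<Sum>u\<in>red N y - {v}. if {u, v} \<in> E then 1 else 0)"
    unfolding sum_negf[symmetric] by (intro sum.cong) (auto simp: lead_weight_red)
  ultimately show ?thesis
    by (subst sum_pairs_star[OF assms(1), of y]) (simp_all add: eq)
qed

text \<open>Chernoff's bound with tilt \<open>s\<close>: the expectation of \<open>s powr lead\<close> factorises over the edges.
  The summand \<open>edge_scale a N\<close> makes up for \<open>v\<close> itself, which is red but not its own
  neighbour.\<close>

lemma prob_blue_leads_le:
  fixes s :: real
  assumes y: "\<And>u. u \<in> vertices N \<Longrightarrow> y u \<in> {1, -1}" and v: "v \<in> red N y" and s: "1 \<le> s"
    and a: "0 \<le> edge_scale a N" "edge_scale a N \<le> 1"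
    and b: "0 \<le> edge_scale b N" "edge_scale b N \<le> 1"
  shows "measure_pmf.prob (graph_pmf a b N y)
      {E. card (neighbours E v \<inter> blue N y) > card (neighbours E v \<inter> red N y)}
    \<le> exp (edge_scale b N * real (card (blue N y)) * (s - 1)
        + edge_scale a N * real (card (red N y)) * (1 / s - 1) + edge_scale a N)"
proof -
  let ?w = "lead_weight N y v" and ?p = "edge_prob a b N y"
  let ?P = "Pi_pmf (pairs N) False (\<lambda>e. bernoulli_pmf (?p e))"
  let ?lead = "\<lambda>X. \<Sum>e\<in>pairs N. if X e then ?w e else 0"
  have vN: "v \<in> vertices N" and yv: "y v = -1" using v by (auto simp: red_def)
  have p: "0 \<le> ?p e" "?p e \<le> 1" for e using a b by (auto simp: edge_prob_def)
  have lead: "?lead X = real (card (neighbours {e \<in> pairs N. X e} v \<inter> blue N y))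
      - real (card (neighbours {e \<in> pairs N. X e} v \<inter> red N y))" for X
    unfolding sum_lead_weight[OF vN, symmetric] by (intro sum.cong) auto
  have fin: "finite (set_pmf ?P)"
    by (simp add: set_Pi_pmf finite_PiE_dflt)
  have "measure_pmf.prob (graph_pmf a b N y)
      {E. card (neighbours E v \<inter> blue N y) > card (neighbours E v \<inter> red N y)}
    = measure_pmf.prob ?P {X. ?lead X > 0}"
    unfolding lead by (simp add: graph_pmf_def vimage_def)
  also have "\<dots> = measure_pmf.expectation ?P (indicator {X. ?lead X > 0})"
    by simp
  \<comment> \<open>Markov's inequality for \<open>s powr lead\<close>, which is at least \<open>1\<close> where blue leads.\<close>
  also have "\<dots> \<le> measure_pmf.expectation ?P (\<lambda>X. s powr ?lead X)"
  proof (rule integral_mono)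
    show "indicator {X. ?lead X > 0} X \<le> s powr ?lead X" for X
      using s by (auto simp: indicator_def intro!: ge_one_powr_ge_zero)
  qed (use fin in \<open>auto intro: integrable_measure_pmf_finite\<close>)
  also have "(\<lambda>X. s powr ?lead X) = (\<lambda>X. \<Prod>e\<in>pairs N. if X e then s powr ?w e else 1)"
    using s by (auto simp: powr_sum intro!: ext prod.cong)
  also have "measure_pmf.expectation ?P \<dots> \<le> exp (\<Sum>e\<in>pairs N. ?p e * (s powr ?w e - 1))"
    by (rule expectation_prod_Pi_pmf_bernoulli_le) (use p in auto)
  also have "(\<Sum>e\<in>pairs N. ?p e * (s powr ?w e - 1))
    = (\<Sum>u\<in>blue N y - {v}. edge_scale b N * (s - 1))
      + (\<Sum>u\<in>red N y - {v}. edge_scale a N * (1 / s - 1))"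
  proof (subst sum_pairs_star[OF vN, of y])
    have "?p {u, v} = edge_scale b N" if "u \<in> blue N y - {v}" for u
      using that yv by (auto simp: edge_prob_def blue_def)
    moreover have "?p {u, v} = edge_scale a N" if "u \<in> red N y - {v}" for u
      using that yv by (auto simp: edge_prob_def red_def)
    ultimately show "(\<Sum>u\<in>blue N y - {v}. ?p {u, v} * (s powr ?w {u, v} - 1))
        + (\<Sum>u\<in>red N y - {v}. ?p {u, v} * (s powr ?w {u, v} - 1))
      = (\<Sum>u\<in>blue N y - {v}. edge_scale b N * (s - 1))
        + (\<Sum>u\<in>red N y - {v}. edge_scale a N * (1 / s - 1))"
      using s by (intro arg_cong2[of _ _ _ _ "(+)"] sum.cong)
        (simp_all add: lead_weight_blue lead_weight_red powr_minus_divide)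
  qed (use s in simp)
  also have "\<dots> = edge_scale b N * real (card (blue N y)) * (s - 1)
      + edge_scale a N * (real (card (red N y)) - 1) * (1 / s - 1)"
  proof -
    have "blue N y - {v} = blue N y" using yv by (auto simp: blue_def)
    moreover have "card (red N y) > 0" using v by (auto simp: card_gt_0_iff)
    ultimately show ?thesis using v by (simp add: of_nat_diff)
  qed
  also have "\<dots> \<le> edge_scale b N * real (card (blue N y)) * (s - 1)
        + edge_scale a N * real (card (red N y)) * (1 / s - 1) + edge_scale a N"
    using a(1) s by (simp add: algebra_simps)
  finally show ?thesis by simp
qed

section \<open>The Markov property along the sequence of graphs\<close>

context majority_dynamics
begin

abbreviation config :: "nat \<Rightarrow> 'w \<Rightarrow> opinions" where
  "config t \<omega> \<equiv> opinion N y0 (\<lambda>s. G s \<omega>) t"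

lemma graph_subset_pairs: "\<omega> \<in> space M \<Longrightarrow> 1 \<le> t \<Longrightarrow> G t \<omega> \<subseteq> pairs N"
  using measurable_space[OF graph] by auto

lemma config_values: "v \<in> vertices N \<Longrightarrow> config t \<omega> v \<in> {1, -1}"
  by (induction t) (use initial majority_update_values in auto)

lemma finite_config_range: "finite (config t ` space M)"
proof (induction t)
  case (Suc t)
  have "config (Suc t) ` space M
      \<subseteq> (\<lambda>(y, E). majority_update N y E) ` (config t ` space M \<times> Pow (pairs N))"
  proof safe
    fix \<omega> assume "\<omega> \<in> space M"
    then show "config (Suc t) \<omega>
        \<in> (\<lambda>(y, E). majority_update N y E) ` (config t ` space M \<times> Pow (pairs N))"
      using graph_subset_pairs[of \<omega> "Suc t"]
      by (intro image_eqI[of _ _ "(config t \<omega>, G (Suc t) \<omega>)"]) auto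
  qed
  then show ?case
    by (rule finite_subset) (use Suc in auto)
qed (simp add: image_constant_conv)

lemma space_history: "space (history M G t) = space M"
  by (simp add: history_def space_measure_of_conv)

lemma sets_history:
  "sets (history M G t)
     = sigma_sets (space M) {G s -` A \<inter> space M | s A. 1 \<le> s \<and> s \<le> t}"
  unfolding history_def by (rule sets_measure_of) auto

lemma graph_event_history:
  "1 \<le> s \<Longrightarrow> s \<le> t \<Longrightarrow> {\<omega> \<in> space M. G s \<omega> = E} \<in> sets (history M G t)"
  unfolding sets_history by (rule sigma_sets.Basic) (auto intro!: exI[of _ s] exI[of _ "{E}"])

lemma subalgebra_history: "subalgebra M (history M G t)"
proof -
  have "G s -` A \<inter> space M \<in> sets M" if "1 \<le> s" for s A
  proof -
    have "G s -` A \<inter> space M = G s -` (A \<inter> Pow (pairs N)) \<inter> space M"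
      using graph_subset_pairs[OF _ that] by auto
    then show ?thesis using measurable_sets[OF graph[OF that], of "A \<inter> Pow (pairs N)"] by simp
  qed
  then have "sets (history M G t) \<subseteq> sets M"
    unfolding sets_history by (intro sets.sigma_sets_subset) auto
  then show ?thesis by (simp add: subalgebra_def space_history)
qed

text \<open>Finitely many configurations and graphs are possible in each round, so the configuration at
  time \<open>s\<close> is decided by finitely many events of the history.\<close>

lemma config_event_history:
  "s \<le> t \<Longrightarrow> {\<omega> \<in> space M. config s \<omega> = y} \<in> sets (history M G t)"
proof (induction s arbitrary: y)
  case 0
  have "{\<omega> \<in> space M. config 0 \<omega> = y} = (if y0 = y then space (history M G t) else {})"
    by (auto simp: space_history)
  then show ?case by (auto split: if_splits)
next
  case (Suc s)
  let ?I = "{(y', E) \<in> config s ` space M \<times> Pow (pairs N). majority_update N y' E = y}"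
  have "{\<omega> \<in> space M. config (Suc s) \<omega> = y}
    = (\<Union>(y', E)\<in>?I. {\<omega> \<in> space M. config s \<omega> = y'} \<inter> {\<omega> \<in> space M. G (Suc s) \<omega> = E})"
    using graph_subset_pairs[of _ "Suc s"] by fastforce
  moreover have "finite ?I"
    by (rule finite_subset[of _ "config s ` space M \<times> Pow (pairs N)"])
      (use finite_config_range in auto)
  ultimately show ?case
    using Suc by (auto intro!: sets.finite_UN graph_event_history)
qed

lemma config_event: "{\<omega> \<in> space M. config t \<omega> = y} \<in> sets M"
  using config_event_history[OF order_refl, of t y] subalgebra_history[of t]
  by (auto simp: subalgebra_def)

lemma graph_event: "{\<omega> \<in> space M. G (Suc t) \<omega> = E} \<in> sets M"
  using graph_event_history[of "Suc t" "Suc t"] subalgebra_history[of "Suc t"]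
  by (auto simp: subalgebra_def)

lemma step_event_eq:
  "{\<omega> \<in> space M. Q (config t \<omega>) (G (Suc t) \<omega>)}
   = (\<Union>y\<in>config t ` space M. \<Union>E\<in>{E \<in> Pow (pairs N). Q y E}.
        {\<omega> \<in> space M. config t \<omega> = y} \<inter> {\<omega> \<in> space M. G (Suc t) \<omega> = E})"
  using graph_subset_pairs[of _ "Suc t"] by fastforce

lemma step_event: "{\<omega> \<in> space M. Q (config t \<omega>) (G (Suc t) \<omega>)} \<in> sets M"
  unfolding step_event_eq using finite_config_range
  by (intro sets.finite_UN sets.Int config_event graph_event) auto

text \<open>Integrating the conditional law over the history event \<open>config t = y\<close>, on which it is
  constant.\<close>

lemma prob_config_graph:
  assumes "E \<subseteq> pairs N"
  shows "prob ({\<omega> \<in> space M. config t \<omega> = y} \<inter> {\<omega> \<in> space M. G (Suc t) \<omega> = E})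
    = prob {\<omega> \<in> space M. config t \<omega> = y} * pmf (graph_pmf a b N y) E"
proof -
  let ?A = "{\<omega> \<in> space M. config t \<omega> = y}" and ?B = "{\<omega> \<in> space M. G (Suc t) \<omega> = E}"
  interpret H: finite_measure_subalgebra M "history M G t"
    by standard (rule subalgebra_history)
  have B [measurable]: "?B \<in> sets M" and A [measurable]: "?A \<in> sets M"
    by (rule graph_event config_event)+
  have "prob (?A \<inter> ?B) = (\<integral>\<omega>\<in>?A. indicator ?B \<omega> \<partial>M)"
    by (simp add: set_lebesgue_integral_def indicator_inter_arith[symmetric])
  also have "\<dots> = (\<integral>\<omega>\<in>?A. real_cond_exp M (history M G t) (indicator ?B) \<omega> \<partial>M)"
    by (rule H.real_cond_exp_intA) (use B config_event_history in \<open>auto simp: less_top[symmetric]\<close>)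
  also have "\<dots> = (\<integral>\<omega>\<in>?A. pmf (graph_pmf a b N y) E \<partial>M)"
    unfolding set_lebesgue_integral_def
  proof (rule integral_cong_AE)
    show "AE \<omega> in M. indicator ?A \<omega> *\<^sub>R real_cond_exp M (history M G t) (indicator ?B) \<omega>
        = indicator ?A \<omega> *\<^sub>R pmf (graph_pmf a b N y) E"
      using conditional_law[OF assms, of t] by eventually_elim (auto simp: indicator_def)
  qed measurable
  also have "\<dots> = prob ?A * pmf (graph_pmf a b N y) E"
    by (simp add: set_lebesgue_integral_def)
  finally show ?thesis .
qed

text \<open>The form of the Markov property used below: a bound that holds for the transition law from
  every reachable configuration holds unconditionally.\<close>

lemma prob_step_le:
  assumes "\<And>\<omega>. \<omega> \<in> space M \<Longrightarrow>
      measure_pmf.prob (graph_pmf a b N (config t \<omega>)) {E. Q (config t \<omega>) E} \<le> q"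
  shows "prob {\<omega> \<in> space M. Q (config t \<omega>) (G (Suc t) \<omega>)} \<le> q"
proof -
  let ?Y = "config t ` space M" and ?A = "\<lambda>y. {\<omega> \<in> space M. config t \<omega> = y}"
  let ?D = "\<lambda>y. {E \<in> Pow (pairs N). Q y E}"
  let ?B = "\<lambda>E. {\<omega> \<in> space M. G (Suc t) \<omega> = E}"
  have "prob {\<omega> \<in> space M. Q (config t \<omega>) (G (Suc t) \<omega>)}
      = (\<Sum>y\<in>?Y. prob (\<Union>E\<in>?D y. ?A y \<inter> ?B E))"
    unfolding step_event_eq
    by (rule finite_measure_finite_Union)
      (use finite_config_range config_event graph_event in
        \<open>auto intro!: sets.finite_UN simp: disjoint_family_on_def\<close>)
  also have "\<dots> \<le> (\<Sum>y\<in>?Y. prob (?A y) * q)"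
  proof (rule sum_mono)
    fix y assume y: "y \<in> ?Y"
    have "prob (\<Union>E\<in>?D y. ?A y \<inter> ?B E) = (\<Sum>E\<in>?D y. prob (?A y \<inter> ?B E))"
      by (rule finite_measure_finite_Union)
        (use config_event graph_event in \<open>auto simp: disjoint_family_on_def\<close>)
    also have "\<dots> = prob (?A y) * (\<Sum>E\<in>?D y. pmf (graph_pmf a b N y) E)"
      by (simp add: prob_config_graph sum_distrib_left)
    also have "(\<Sum>E\<in>?D y. pmf (graph_pmf a b N y) E) \<le> q"
    proof -
      have "(\<Sum>E\<in>?D y. pmf (graph_pmf a b N y) E) = measure_pmf.prob (graph_pmf a b N y) (?D y)"
        by (simp add: measure_measure_pmf_finite)
      also have "\<dots> \<le> measure_pmf.prob (graph_pmf a b N y) {E. Q y E}"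
        by (rule measure_pmf.finite_measure_mono) auto
      also have "\<dots> \<le> q" using y assms by auto
      finally show ?thesis .
    qed
    finally show "prob (\<Union>E\<in>?D y. ?A y \<inter> ?B E) \<le> prob (?A y) * q"
      by (simp add: mult_left_mono)
  qed
  also have "\<dots> = prob (\<Union>y\<in>?Y. ?A y) * q"
    unfolding sum_distrib_right[symmetric]
    by (subst finite_measure_finite_Union)
      (use finite_config_range config_event in \<open>auto simp: disjoint_family_on_def\<close>)
  also have "(\<Union>y\<in>?Y. ?A y) = space M" by auto
  finally show ?thesis by (simp add: prob_space)
qed

section \<open>Counting defections from red\<close>

text \<open>The clause on \<open>r\<close> restricts attention to rounds that start with at least \<open>r\<close> red vertices,
  where the one-round estimate is available.\<close>

definition defection :: "real \<Rightarrow> nat \<Rightarrow> nat \<Rightarrow> 'w set" where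
  "defection r t v = {\<omega> \<in> space M. r \<le> real (card (red N (config t \<omega>)))
     \<and> v \<in> red N (config t \<omega>) \<and> v \<notin> red N (config (Suc t) \<omega>)}"

definition defections :: "real \<Rightarrow> nat \<Rightarrow> 'w \<Rightarrow> real" where
  "defections r T \<omega> = (\<Sum>t<T. \<Sum>v\<in>vertices N. indicator (defection r t v) \<omega>)"

lemma defection_event: "defection r t v \<in> sets M"
  using step_event[of "\<lambda>y E. r \<le> real (card (red N y)) \<and> v \<in> red N y
    \<and> v \<notin> red N (majority_update N y E)" t]
  by (simp add: defection_def)

lemma card_red_le_add_defections:
  assumes "\<omega> \<in> space M" and "\<And>t. t < n \<Longrightarrow> r \<le> real (card (red N (config t \<omega>)))"
  shows "real (card (red N y0)) \<le> real (card (red N (config n \<omega>))) + defections r n \<omega>"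
  using assms(2)
proof (induction n)
  case (Suc n)
  let ?R = "red N (config n \<omega>)" and ?R' = "red N (config (Suc n) \<omega>)"
  have "(\<Sum>v\<in>vertices N. indicator (defection r n v) \<omega>) = (\<Sum>v\<in>?R - ?R'. 1 :: real)"
    using assms(1) Suc.prems[of n]
    by (intro sum.mono_neutral_cong_right) (auto simp: defection_def indicator_def red_def)
  moreover have "card ?R \<le> card ?R' + card (?R - ?R')"
    using card_mono[of "?R' \<union> (?R - ?R')" ?R] card_Un_le[of ?R' "?R - ?R'"] by fastforce
  ultimately show ?case
    using Suc.IH Suc.prems by (simp add: defections_def)
qed (simp add: defections_def)

text \<open>Restricting the count to rounds that start with at least \<open>r\<close> red vertices loses nothing: up to
  the first time that fewer than \<open>r\<close> are red, every defection is counted. This replaces a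
  stopping time.\<close>

lemma defections_ge_if_few_red:
  assumes "\<omega> \<in> space M" and "real (card (red N (config T \<omega>))) < r"
  shows "real (card (red N y0)) - r \<le> defections r T \<omega>"
proof -
  define n where "n = (LEAST n. real (card (red N (config n \<omega>))) < r)"
  have n: "real (card (red N (config n \<omega>))) < r" "n \<le> T"
    unfolding n_def by (rule LeastI, rule assms(2)) (rule Least_le, rule assms(2))
  have "real (card (red N y0)) \<le> real (card (red N (config n \<omega>))) + defections r n \<omega>"
  proof (rule card_red_le_add_defections[OF assms(1)])
    fix t assume "t < n"
    from not_less_Least[OF this[unfolded n_def]]
    show "r \<le> real (card (red N (config t \<omega>)))" by simp
  qed
  then
  have "real (card (red N y0)) - r \<le> defections r n \<omega>" using n by simp
  also have "\<dots> \<le> defections r T \<omega>"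
    unfolding defections_def using n by (intro sum_mono2) (auto intro!: sum_nonneg)
  finally show ?thesis .
qed

text \<open>Markov's inequality for the number of defections; \<open>q\<close> bounds the probability that a single
  red vertex turns blue in one round.\<close>

lemma prob_few_red_le:
  assumes q: "\<And>y v. (\<And>u. u \<in> vertices N \<Longrightarrow> y u \<in> {1, -1}) \<Longrightarrow> r \<le> real (card (red N y)) \<Longrightarrow>
      v \<in> red N y \<Longrightarrow> measure_pmf.prob (graph_pmf a b N y)
        {E. card (neighbours E v \<inter> blue N y) > card (neighbours E v \<inter> red N y)} \<le> q"
    and "0 \<le> q" and r: "r < real (card (red N y0))"
  shows "prob {\<omega> \<in> space M. real (card (red N (config T \<omega>))) < r}
    \<le> real T * real N * q / (real (card (red N y0)) - r)"
proof -
  let ?d = "real (card (red N y0)) - r"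
  have prob_defection: "prob (defection r t v) \<le> q" for t v
  proof -
    let ?Q = "\<lambda>y E. r \<le> real (card (red N y)) \<and> v \<in> red N y \<and> v \<notin> red N (majority_update N y E)"
    have "prob {\<omega> \<in> space M. ?Q (config t \<omega>) (G (Suc t) \<omega>)} \<le> q"
    proof (rule prob_step_le)
      fix \<omega> assume "\<omega> \<in> space M"
      show "measure_pmf.prob (graph_pmf a b N (config t \<omega>)) {E. ?Q (config t \<omega>) E} \<le> q"
      proof (cases "r \<le> real (card (red N (config t \<omega>))) \<and> v \<in> red N (config t \<omega>)")
        case True
        then show ?thesis using q[of "config t \<omega>" v] config_values
          by (simp add: turns_blue_iff del: insert_iff)
      next
        case False
        then have "{E. ?Q (config t \<omega>) E} = {}" by auto
        then show ?thesis unfolding \<open>{E. ?Q (config t \<omega>) E} = {}\<close> using \<open>0 \<le> q\<close> by simp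
      qed
    qed
    then show ?thesis by (simp add: defection_def)
  qed
  have [measurable]: "defections r T \<in> borel_measurable M"
    unfolding defections_def using defection_event by measurable
  have int_indicator: "integrable M (indicator (defection r t v) :: 'w \<Rightarrow> real)" for t v
    using defection_event by (simp add: less_top[symmetric])
  then have int: "integrable M (defections r T)"
    unfolding defections_def by (intro Bochner_Integration.integrable_sum)
  have nonneg: "0 \<le> defections r T \<omega>" for \<omega>
    unfolding defections_def by (intro sum_nonneg) auto
  have "{\<omega> \<in> space M. real (card (red N (config T \<omega>))) < r}
      \<subseteq> {\<omega> \<in> space M. ?d \<le> defections r T \<omega>}"
    using defections_ge_if_few_red by auto
  then have "prob {\<omega> \<in> space M. real (card (red N (config T \<omega>))) < r}
      \<le> prob {\<omega> \<in> space M. ?d \<le> defections r T \<omega>}"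
    by (rule finite_measure_mono) measurable
  also have "\<dots> \<le> expectation (defections r T) / ?d"
    by (rule integral_Markov_inequality_measure[where A = "{}"])
      (use int r nonneg in auto)
  also have "expectation (defections r T) = (\<Sum>t<T. \<Sum>v\<in>vertices N. prob (defection r t v))"
    unfolding defections_def using defection_event
    by (simp add: int_indicator)
  also have "\<dots> \<le> (\<Sum>t<T. \<Sum>v\<in>vertices N. q)"
    by (intro sum_mono prob_defection)
  also have "\<dots> = real T * real N * q" by (simp add: vertices_def)
  finally show ?thesis using r by (simp add: divide_right_mono)
qed

end

section \<open>The survival of red\<close>

text \<open>The tilt \<open>sqrt x / sqrt y\<close> minimises the exponent of Chernoff's bound: both \<open>y * s\<close> and \<open>x / s\<close>
  become \<open>sqrt x * sqrt y\<close>, which completes the square.\<close>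

lemma optimal_tilt:
  fixes x y :: real
  assumes "0 < y" "y \<le> x"
  shows "y * (sqrt x / sqrt y - 1) + x * (1 / (sqrt x / sqrt y) - 1) = - rate x y"
proof -
  define p q where "p = sqrt x" and "q = sqrt y"
  have pq: "0 < q" "q \<le> p" "x = p * p" "y = q * q"
    using assms by (auto simp: p_def q_def)
  then have "y * (p / q - 1) + x * (1 / (p / q) - 1) = - (p - q)\<^sup>2"
    by (simp add: field_simps power2_eq_square)
  then show ?thesis
    using pq by (simp add: rate_def p_def[symmetric] q_def[symmetric])
qed

text \<open>The tilt is chosen optimal for the initial configuration and kept for all configurations
  with at least \<open>card (red N y0) - d\<close> red vertices. The exponent is then linear in the number of
  red vertices, and for small \<open>d\<close> the loss of \<open>d\<close> red vertices is harmless.\<close>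

lemma prob_blue_leads_le_initial_rate:
  fixes a b d :: real
  assumes ab: "1 < b" "b < a" and N: "0 < N" "edge_scale a N \<le> 1"
    and y0: "\<And>u. u \<in> vertices N \<Longrightarrow> y0 u \<in> {1, -1}"
    and ratio: "1 < initial_ratio N y0" "initial_ratio N y0 \<le> a / b"
    and d: "0 \<le> d" "d * (2 * edge_scale a N) \<le> 1"
    and y: "\<And>u. u \<in> vertices N \<Longrightarrow> y u \<in> {1, -1}"
    and many: "real (card (red N y0)) - d \<le> real (card (red N y))" and v: "v \<in> red N y"
  shows "measure_pmf.prob (graph_pmf a b N y)
      {E. card (neighbours E v \<inter> blue N y) > card (neighbours E v \<inter> red N y)}
    \<le> exp 2 * real N powr (- initial_rate a b N y0)"
proof -
  define R0 B0 R B where "R0 = real (card (red N y0))" and "B0 = real (card (blue N y0))"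
    and "R = real (card (red N y))" and "B = real (card (blue N y))"
  define \<alpha> \<beta> where "\<alpha> = edge_scale a N" and "\<beta> = edge_scale b N"
  have R0: "0 < R0"
    using ratio(1) by (cases "card (red N y0) = 0") (auto simp: initial_ratio_def R0_def)
  have RB0: "R0 < B0" "b * B0 \<le> a * R0"
  proof -
    have "1 < B0 / R0" "B0 / R0 \<le> a / b"
      using ratio by (simp_all add: initial_ratio_def R0_def B0_def)
    then show "R0 < B0" "b * B0 \<le> a * R0" using R0 ab by (simp_all add: field_simps)
  qed
  have "B0 + R0 = real N" "B + R = real N"
    unfolding R_def B_def R0_def B0_def of_nat_add[symmetric]
    using y0 y by (simp_all only: card_blue_add_card_red)
  then have RB: "R0 - d \<le> R" "B \<le> B0 + d"
    using many unfolding R_def[symmetric] R0_def[symmetric] by linarith+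
  have \<beta>: "0 \<le> \<beta>" "\<beta> \<le> \<alpha>" "\<alpha> \<le> 1"
    using N ab by (auto simp: \<alpha>_def \<beta>_def edge_scale_def intro!: divide_right_mono mult_right_mono)
  define x z where "x = a * R0 / real N" and "z = b * B0 / real N"
  have xz: "0 < z" "z \<le> x"
    using R0 RB0 ab N by (auto simp: x_def z_def intro!: divide_right_mono)
  define s where "s = sqrt x / sqrt z"
  have s1: "1 \<le> s" using xz by (simp add: s_def)
  have "s \<le> a / b"
  proof -
    have "x / z = (a / b) * (R0 / B0)" using N by (simp add: x_def z_def)
    also have "\<dots> \<le> (a / b) * 1" using RB0 R0 ab by (intro mult_left_mono) auto
    finally have "s \<le> sqrt (a / b)" by (simp add: s_def real_sqrt_divide[symmetric])
    also have "\<dots> \<le> a / b" using ab by (intro real_le_lsqrt self_le_power) auto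
    finally show ?thesis .
  qed
  \<comment> \<open>With this, exchanging \<open>d\<close> red vertices for blue ones raises the exponent by at most \<open>2 d \<alpha>\<close>.\<close>
  then have \<beta>s: "\<beta> * s \<le> \<alpha>"
  proof -
    have "b * s \<le> a" using \<open>s \<le> a / b\<close> ab by (simp add: field_simps)
    then have "(b * s) * (ln (real N) / real N) \<le> a * (ln (real N) / real N)"
      using N by (intro mult_right_mono) auto
    then show ?thesis by (simp add: \<alpha>_def \<beta>_def edge_scale_def mult_ac)
  qed
  have "\<beta> * B * (s - 1) + \<alpha> * R * (1 / s - 1) + \<alpha>
      \<le> \<beta> * (B0 + d) * (s - 1) + \<alpha> * (R0 - d) * (1 / s - 1) + \<alpha>"
    using RB \<beta> s1
    by (intro add_mono order_refl mult_right_mono mult_left_mono mult_right_mono_neg) auto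
  also have "\<dots> = ln (real N) * (z * (s - 1) + x * (1 / s - 1))
      + d * (\<beta> * (s - 1) + \<alpha> * (1 - 1 / s)) + \<alpha>"
    by (simp add: \<alpha>_def \<beta>_def edge_scale_def x_def z_def algebra_simps
        add_divide_distrib diff_divide_distrib)
  also have "\<dots> \<le> ln (real N) * (- initial_rate a b N y0) + d * (2 * \<alpha>) + 1"
  proof (intro add_mono)
    show "ln (real N) * (z * (s - 1) + x * (1 / s - 1)) \<le> ln (real N) * (- initial_rate a b N y0)"
      using optimal_tilt[OF xz]
      by (simp add: s_def initial_rate_def x_def z_def R0_def B0_def)
    have "\<alpha> * (1 - 1 / s) \<le> \<alpha> * 1" using \<beta> s1 by (intro mult_left_mono) auto
    then have "\<beta> * (s - 1) + \<alpha> * (1 - 1 / s) \<le> 2 * \<alpha>"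
      using \<beta>s \<beta> by (simp add: algebra_simps)
    then show "d * (\<beta> * (s - 1) + \<alpha> * (1 - 1 / s)) \<le> d * (2 * \<alpha>)"
      using d(1) by (rule mult_left_mono)
  qed (use \<beta> in auto)
  also have "\<dots> \<le> 2 - initial_rate a b N y0 * ln (real N)"
    using d(2) by (simp add: \<alpha>_def mult.commute)
  finally have "exp (\<beta> * B * (s - 1) + \<alpha> * R * (1 / s - 1) + \<alpha>)
      \<le> exp (2 - initial_rate a b N y0 * ln (real N))" by simp
  also have "\<dots> = exp 2 * real N powr (- initial_rate a b N y0)"
    using N by (simp add: powr_def exp_add[symmetric])
  finally show ?thesis
    using prob_blue_leads_le[OF y v s1, of a b] \<beta>
    by (simp add: \<alpha>_def \<beta>_def R_def B_def)
qed

context majority_dynamics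
begin

text \<open>In the bound of \<open>prob_few_red_le\<close> the rate cancels between the number of rounds and the
  probability of a defection, leaving \<open>N powr (- \<epsilon>)\<close> times \<open>N / d\<close>. The last two assumptions hold
  for large \<open>N\<close>: the first makes \<open>d\<close> smaller than the initial number of red vertices, the second
  makes the loss of \<open>d\<close> red vertices harmless for the one-round estimate.\<close>

lemma prob_red_survives_ge:
  fixes \<epsilon> :: real
  assumes ab: "1 < b" "b < a" and N: "0 < N"
    and ratio: "1 < initial_ratio N y0" "initial_ratio N y0 \<le> a / b"
    and many: "real N powr (1 - \<epsilon> / 2) * (1 + a / b) < real N"
    and small: "real N powr (1 - \<epsilon> / 2) * (2 * edge_scale a N) \<le> 1"
  shows "1 - exp 2 * real N powr (- \<epsilon> / 2) \<le> prob {\<omega> \<in> space M.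
      red N (config (nat \<lfloor>real N powr (initial_rate a b N y0 - \<epsilon>)\<rfloor>) \<omega>) \<noteq> {}}"
proof -
  define I d where "I = initial_rate a b N y0" and "d = real N powr (1 - \<epsilon> / 2)"
  define T where "T = nat \<lfloor>real N powr (I - \<epsilon>)\<rfloor>"
  define R0 where "R0 = real (card (red N y0))"
  have d: "0 < d" using N by (simp add: d_def)
  have "d < R0"
  proof -
    have "0 < R0"
      using ratio(1) by (cases "card (red N y0) = 0") (auto simp: initial_ratio_def R0_def)
    moreover have "real (card (blue N y0)) + R0 = real N"
      unfolding R0_def of_nat_add[symmetric] using initial by (simp only: card_blue_add_card_red)
    moreover have "real (card (blue N y0)) / R0 \<le> a / b"
      using ratio(2) by (simp add: initial_ratio_def R0_def)
    ultimately have "real N \<le> R0 * (1 + a / b)"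
      by (simp add: pos_divide_le_eq distrib_left mult.commute)
    then have "d * (1 + a / b) < R0 * (1 + a / b)" using many by (simp add: d_def)
    then show ?thesis using ab by (subst (asm) mult_less_cancel_right_pos) (auto intro: add_pos_pos)
  qed
  let ?few = "{\<omega> \<in> space M. real (card (red N (config T \<omega>))) < R0 - d}"
  have "prob ?few \<le> real T * real N * (exp 2 * real N powr (- I)) / (R0 - (R0 - d))"
    unfolding R0_def
  proof (rule prob_few_red_le)
    fix y v
    assume "\<And>u. u \<in> vertices N \<Longrightarrow> y u \<in> {1, -1}"
      and "real (card (red N y0)) - d \<le> real (card (red N y))" and "v \<in> red N y"
    from prob_blue_leads_le_initial_rate[OF ab N scale_le_1 initial ratio _ _ this]
    show "measure_pmf.prob (graph_pmf a b N y)
        {E. card (neighbours E v \<inter> blue N y) > card (neighbours E v \<inter> red N y)}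
      \<le> exp 2 * real N powr (- I)"
      using d small by (simp add: I_def d_def)
  qed (use d in auto)
  also have "\<dots> \<le> real N powr (I - \<epsilon>) * real N * (exp 2 * real N powr (- I)) / d"
  proof -
    have "real T \<le> real N powr (I - \<epsilon>)" by (simp add: T_def)
    then show ?thesis using d by (auto intro!: divide_right_mono mult_right_mono)
  qed
  also have "\<dots> = exp 2 * (real N powr ((I - \<epsilon>) + 1 + (- I) - (1 - \<epsilon> / 2)))"
    using N unfolding powr_add powr_diff d_def by simp
  also have "(I - \<epsilon>) + 1 + (- I) - (1 - \<epsilon> / 2) = - \<epsilon> / 2" by simp
  finally have few: "prob ?few \<le> exp 2 * real N powr (- \<epsilon> / 2)" .
  have event: "{\<omega> \<in> space M. P (config T \<omega>)} \<in> sets M" for P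
    using step_event[of "\<lambda>y E. P y" T] .
  have "1 - prob ?few = prob (space M - ?few)"
    by (rule prob_compl[symmetric]) (rule event)
  also have "\<dots> \<le> prob {\<omega> \<in> space M. red N (config T \<omega>) \<noteq> {}}"
    using \<open>d < R0\<close> by (intro finite_measure_mono event) auto
  finally show ?thesis using few by (simp add: T_def I_def)
qed

end

theorem theorem1p9:
  fixes a b \<kappa> \<epsilon> :: real
  assumes "a > b" and "b > 1" and "\<kappa> > 0" and "\<epsilon> > 0"
  shows "\<exists>C>0. \<forall>\<^sub>F N in sequentially.
    \<forall>(y0 :: opinions) (M :: 'w measure) G.
      majority_dynamics M a b N y0 G \<longrightarrow>
      1 < initial_ratio N y0 \<longrightarrow>
      initial_ratio N y0 \<le> a / b - \<kappa> \<longrightarrow>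
      measure M {\<omega> \<in> space M.
          red N (opinion N y0 (\<lambda>s. G s \<omega>)
            (nat \<lfloor>real N powr (initial_rate a b N y0 - \<epsilon>)\<rfloor>)) \<noteq> {}}
        \<ge> 1 - C * real N powr (- \<epsilon> / 2)"
proof (intro exI[of _ "exp 2"] conjI)
  have "(\<lambda>N. real N powr (- (\<epsilon> / 2)) * (1 + a / b)) \<longlonglongrightarrow> 0 * (1 + a / b)"
    using \<open>\<epsilon> > 0\<close>
    by (intro tendsto_mult tendsto_neg_powr filterlim_real_sequentially tendsto_const) auto
  then have many: "\<forall>\<^sub>F N in sequentially. real N powr (- (\<epsilon> / 2)) * (1 + a / b) < 1"
    by (rule order_tendstoD) simp
  have "(\<lambda>N. 2 * a * (ln (real N) / real N powr (\<epsilon> / 2))) \<longlonglongrightarrow> 2 * a * 0"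
    using \<open>\<epsilon> > 0\<close> by (intro tendsto_mult tendsto_const lim_ln_over_power) auto
  then have small: "\<forall>\<^sub>F N in sequentially. 2 * a * (ln (real N) / real N powr (\<epsilon> / 2)) < 1"
    by (rule order_tendstoD) simp
  show "\<forall>\<^sub>F N in sequentially. \<forall>(y0 :: opinions) (M :: 'w measure) G.
      majority_dynamics M a b N y0 G \<longrightarrow>
      1 < initial_ratio N y0 \<longrightarrow>
      initial_ratio N y0 \<le> a / b - \<kappa> \<longrightarrow>
      measure M {\<omega> \<in> space M.
          red N (opinion N y0 (\<lambda>s. G s \<omega>)
            (nat \<lfloor>real N powr (initial_rate a b N y0 - \<epsilon>)\<rfloor>)) \<noteq> {}}
        \<ge> 1 - exp 2 * real N powr (- \<epsilon> / 2)"
    using many small eventually_gt_at_top[of 0]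
  proof (eventually_elim, intro allI impI)
    fix N y0 G and M :: "'w measure"
    assume N: "0 < N" and many: "real N powr (- (\<epsilon> / 2)) * (1 + a / b) < 1"
      and small: "2 * a * (ln (real N) / real N powr (\<epsilon> / 2)) < 1"
      and dyn: "majority_dynamics M a b N y0 G"
      and ratio: "1 < initial_ratio N y0" "initial_ratio N y0 \<le> a / b - \<kappa>"
    interpret majority_dynamics M a b N y0 G by (fact dyn)
    have split: "real N powr (1 - \<epsilon> / 2) = real N * real N powr (- (\<epsilon> / 2))"
      using N by (simp add: powr_diff powr_minus_divide)
    show "1 - exp 2 * real N powr (- \<epsilon> / 2) \<le> prob {\<omega> \<in> space M.
      red N (config (nat \<lfloor>real N powr (initial_rate a b N y0 - \<epsilon>)\<rfloor>) \<omega>) \<noteq> {}}"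
    proof (rule prob_red_survives_ge)
      show "real N powr (1 - \<epsilon> / 2) * (1 + a / b) < real N"
        using mult_strict_left_mono[OF many, of "real N"] N unfolding split by simp
      show "real N powr (1 - \<epsilon> / 2) * (2 * edge_scale a N) \<le> 1"
        using small N unfolding split by (simp add: edge_scale_def powr_minus_divide)
    qed (use assms ratio N in auto)
  qed
qed simp

end
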